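(* The vector space $\mathbb U$ becomes a $U_q(\widehat{\mathfrak{sl}}_2)$-module on which the generators of $U_q(\widehat{\mathfrak{sl}}_2)$ act as follows: $E_0$ acts as $A^*_R$; $F_0$ acts as $\dfrac{qA_rK^{-1}-q^{-1}A_\ell}{q-q^{-1}}$; $K_0^{\pm1}$ acts as $q^{\pm1}K^{\mp1}$; $E_1$ acts as $B^*_R$; $F_1$ acts as $\dfrac{B_rK-B_\ell}{q-q^{-1}}$; $K_1^{\pm1}$ acts as $K^{\pm1}$; $D^{\pm1}$ acts as $X^{\mp1}$.
   Context: $\mathbb F$ is a field of characteristic zero and $q\in\mathbb F$ is nonzero and not a root of unity. All vector spaces and algebras are over $\mathbb F$; algebras are associative with unit. The $q$-shuffle algebra. $\mathbb V$ is the free algebra on noncommuting $x,y$ (called letters); words $\ell_1\ell_2\cdots\ell_n$ in the letters form a basis of $\mathbb V$, and $\mathbf 1$ denotes the empty word. Set $(x,x)=(y,y)=2$, $(x,y)=(y,x)=-2$. The $q$-shuffle product $\star$ is the associative bilinear product on $\mathbb V$ with $\mathbf 1\star v=v\star\mathbf 1=v$ for $v\in\mathbb V$, and for nonempty words $u=u_1\cdots u_r$, $v=v_1\cdots v_s$: $u\star v=u_1\bigl((u_2\cdots u_r)\star v\bigr)+v_1\bigl(u\star(v_2\cdots v_s)\bigr)q^{(u_1,v_1)+(u_2,v_1)+\cdots+(u_r,v_1)}$. $\mathbb U$ is the subalgebra of the $q$-shuffle algebra $(\mathbb V,\star)$ generated by $x,y$. Linear maps $\mathbb V\to\mathbb V$.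 $X$ is the automorphism of the free algebra $\mathbb V$ with $x\mapsto qx$, $y\mapsto y$; $K$ is the automorphism of the free algebra $\mathbb V$ with $x\mapsto q^2x$, $y\mapsto q^{-2}y$. $A^*_R$ and $B^*_R$ send $\mathbf 1\mapsto0$ and, for a nonempty word, $A^*_R(\ell_1\cdots\ell_n)=\delta_{\ell_n,x}\,\ell_1\cdots\ell_{n-1}$, $B^*_R(\ell_1\cdots\ell_n)=\delta_{\ell_n,y}\,\ell_1\cdots\ell_{n-1}$, where $\delta$ is the Kronecker delta. For $v\in\mathbb V$: $A_\ell v=x\star v$, $B_\ell v=y\star v$, $A_rv=v\star x$, $B_rv=v\star y$. The actions in the claim are the restrictions of these maps to $\mathbb U$ (that $\mathbb U$ is invariant under them is part of the assertion). The algebra $U_q(\widehat{\mathfrak{sl}}_2)$. Write $[a,b]=ab-ba$ and $[a,b]_p=p\,ab-p^{-1}ba$. Let $\mathbf A=\begin{pmatrix}2&-2\\-2&2\end{pmatrix}$ with rows and columns indexed by $0,1$. $U_q(\widehat{\mathfrak{sl}}_2)$ is the algebra with generators $K_i^{\pm1},D^{\pm1},E_i,F_i$ ($i\in\{0,1\}$) and relations, for $i,j\in\{0,1\}$: $K_iK_i^{-1}=K_i^{-1}K_i=1$, $DD^{-1}=D^{-1}D=1$; $[K_i,K_j]=0$, $[D,K_i]=0$; $K_iE_jK_i^{-1}=q^{\mathbf A_{i,j}}E_j$, $K_iF_jK_i^{-1}=q^{-\mathbf A_{i,j}}F_j$; $DE_0D^{-1}=qE_0$, $DF_0D^{-1}=q^{-1}F_0$,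 $[D,E_1]=0$, $[D,F_1]=0$; $[E_i,F_j]=\delta_{i,j}\frac{K_i-K_i^{-1}}{q-q^{-1}}$; and for $i\ne j$, $[E_i,[E_i,[E_i,E_j]_q]_{q^{-1}}]=0$, $[F_i,[F_i,[F_i,F_j]_q]_{q^{-1}}]=0$. *)

theory Defs
  imports
    "HOL-Algebra.Algebraic_Closure_Type"
    "HOL-Library.Poly_Mapping"
begin

section \<open>Free algebras\<close>

text \<open>
  The free monoid on \<open>'l\<close> is the type of lists over \<open>'l\<close> under concatenation.  It is written
  additively because multiplication on \<open>\<Rightarrow>\<^sub>0\<close> adds keys.  With this instance the ring
  \<open>'l list \<Rightarrow>\<^sub>0 'f\<close> is the free algebra on \<open>'l\<close>, and its unit is the empty word.
\<close>

instantiation list :: (type) monoid_add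
begin
definition zero_list :: "'a list" where "zero_list = []"
definition plus_list :: "'a list \<Rightarrow> 'a list \<Rightarrow> 'a list" where "plus_list = (@)"
instance by standard (simp_all add: zero_list_def plus_list_def)
end

type_synonym ('l, 'f) free_alg = "'l list \<Rightarrow>\<^sub>0 'f"

definition word :: "'l list \<Rightarrow> ('l, 'f::field) free_alg"
  where "word w = Poly_Mapping.single w 1"

definition letter :: "'l \<Rightarrow> ('l, 'f::field) free_alg"
  where "letter l = word [l]"

definition scale :: "'f::field \<Rightarrow> ('l, 'f) free_alg \<Rightarrow> ('l, 'f) free_alg"
  where "scale c v = Poly_Mapping.map ((*) c) v"

lemma lookup_scale [simp]: "Poly_Mapping.lookup (scale c v) w = c * Poly_Mapping.lookup v w"
  by (simp add: scale_def Poly_Mapping.map.rep_eq when_def)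

global_interpretation free_alg: vector_space scale
  by standard (auto intro!: poly_mapping_eqI simp: lookup_add algebra_simps)

lemma word_Nil: "word [] = 1"
  by (simp add: word_def flip: single_one zero_list_def)

lemma word_append: "word (u @ v) = word u * word v"
  by (simp add: word_def mult_single plus_list_def)

lemma scale_single: "scale c (Poly_Mapping.single w d) = Poly_Mapping.single w (c * d)"
  by (rule poly_mapping_eqI) (simp add: lookup_single when_def)

lemma single_conv_word: "Poly_Mapping.single w c = scale c (word w)"
  by (simp add: word_def scale_single)

lemma free_alg_induct [case_names word add]:
  assumes "\<And>c w. P (scale c (word w))" "\<And>u v. P u \<Longrightarrow> P v \<Longrightarrow> P (u + v)"
  shows "P v"
proof -
  have "P (\<Sum>w\<in>A. scale (Poly_Mapping.lookup v w) (word w))" if "finite A" for A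
    using that
  proof induction
    case empty
    show ?case using assms(1)[of 0] by simp
  qed (auto intro: assms)
  moreover have "v = (\<Sum>w\<in>Poly_Mapping.keys v. scale (Poly_Mapping.lookup v w) (word w))"
    by (rule poly_mapping_eqI)
       (simp add: lookup_sum word_def lookup_single when_def in_keys_iff
         if_distrib[of "(*) _"] cong: if_cong)
  ultimately show ?thesis by (metis finite_keys)
qed

lemma scale_mult_left: "scale c (u * v) = scale c u * v"
proof -
  have *: "scale c v = Poly_Mapping.single [] c * v" for v :: "('a, 'b) free_alg"
    by (induction v rule: free_alg_induct)
       (simp_all add: word_def scale_single mult_single plus_list_def free_alg.scale_right_distrib distrib_left)
  show ?thesis by (simp add: * mult.assoc)
qed

lemma scale_mult_right: "scale c (u * v) = u * scale c v"
proof -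
  have *: "scale c u = u * Poly_Mapping.single [] c" for u :: "('a, 'b) free_alg"
    by (induction u rule: free_alg_induct)
       (simp_all add: word_def scale_single mult_single plus_list_def free_alg.scale_right_distrib
         distrib_right mult.commute)
  show ?thesis by (simp add: * mult.assoc)
qed

text \<open>The linear extension of a map given on the basis of words:\<close>

definition lin_ext :: "('l list \<Rightarrow> ('m, 'f) free_alg) \<Rightarrow> ('l, 'f::field) free_alg \<Rightarrow> ('m, 'f) free_alg"
  where "lin_ext f v = (\<Sum>w\<in>Poly_Mapping.keys v. scale (Poly_Mapping.lookup v w) (f w))"

lemma lin_ext_word [simp]: "lin_ext f (word w) = f w"
  by (simp add: lin_ext_def word_def)

lemma lin_ext_superset:
  assumes "finite A" "Poly_Mapping.keys v \<subseteq> A"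
  shows "lin_ext f v = (\<Sum>w\<in>A. scale (Poly_Mapping.lookup v w) (f w))"
  unfolding lin_ext_def using assms
  by (intro sum.mono_neutral_left) (auto simp: in_keys_iff)

lemma lin_ext_add: "lin_ext f (u + v) = lin_ext f u + lin_ext f v"
proof -
  let ?A = "Poly_Mapping.keys u \<union> Poly_Mapping.keys v"
  show ?thesis
    using Poly_Mapping.keys_add[of u v]
    by (simp add: lin_ext_superset[of ?A] lookup_add free_alg.scale_left_distrib sum.distrib)
qed

lemma lin_ext_scale: "lin_ext f (scale c v) = scale c (lin_ext f v)"
  by (subst lin_ext_superset[of "Poly_Mapping.keys v"])
     (auto simp: in_keys_iff lin_ext_def free_alg.scale_sum_right)

text \<open>The algebra homomorphism with given values on the letters:\<close>

definition alg_ext :: "('l \<Rightarrow> ('m, 'f) free_alg) \<Rightarrow> ('l, 'f::field) free_alg \<Rightarrow> ('m, 'f) free_alg"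
  where "alg_ext \<phi> = lin_ext (\<lambda>w. prod_list (map \<phi> w))"

lemma alg_ext_letter: "alg_ext \<phi> (letter l) = \<phi> l"
  by (simp add: alg_ext_def letter_def)

lemma alg_ext_word: "alg_ext \<phi> (word w) = prod_list (map \<phi> w)"
  by (simp add: alg_ext_def)

lemma alg_ext_one: "alg_ext \<phi> 1 = 1"
  by (simp add: alg_ext_word flip: word_Nil)

lemma alg_ext_add: "alg_ext \<phi> (u + v) = alg_ext \<phi> u + alg_ext \<phi> v"
  by (simp add: alg_ext_def lin_ext_add)

lemma alg_ext_scale: "alg_ext \<phi> (scale c v) = scale c (alg_ext \<phi> v)"
  by (simp add: alg_ext_def lin_ext_scale)

lemma alg_ext_mult: "alg_ext \<phi> (u * v) = alg_ext \<phi> u * alg_ext \<phi> v"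
proof (induction u rule: free_alg_induct)
  case (word c w)
  have "alg_ext \<phi> (word w * v) = alg_ext \<phi> (word w) * alg_ext \<phi> v"
    by (induction v rule: free_alg_induct)
       (simp_all add: distrib_left alg_ext_add alg_ext_scale alg_ext_word single_conv_word
         flip: scale_mult_right word_append)
  then show ?case
    by (simp add: single_conv_word alg_ext_scale flip: scale_mult_left)
next
  case (add u1 u2)
  then show ?case by (simp add: distrib_right alg_ext_add)
qed


section \<open>The \<open>q\<close>-shuffle algebra\<close>

datatype xy = Lx | Ly

definition xy_form :: "xy \<Rightarrow> xy \<Rightarrow> int"
  where "xy_form a b = (if a = b then 2 else - 2)"

fun shuffle_words :: "'f::field \<Rightarrow> xy list \<Rightarrow> xy list \<Rightarrow> (xy, 'f) free_alg" where
  "shuffle_words q [] v = word v"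
| "shuffle_words q u [] = word u"
| "shuffle_words q (a # u) (b # v) =
     letter a * shuffle_words q u (b # v)
     + scale (q powi (\<Sum>c\<leftarrow>a # u. xy_form c b)) (letter b * shuffle_words q (a # u) v)"

definition qshuffle :: "'f::field \<Rightarrow> (xy, 'f) free_alg \<Rightarrow> (xy, 'f) free_alg \<Rightarrow> (xy, 'f) free_alg"
  where "qshuffle q f g = lin_ext (\<lambda>u. lin_ext (\<lambda>v. shuffle_words q u v) g) f"

text \<open>The subalgebra of the \<open>q\<close>-shuffle algebra generated by the two letters:\<close>

inductive_set qsh_sub :: "'f::field \<Rightarrow> (xy, 'f) free_alg set" for q where
  one: "1 \<in> qsh_sub q"
| letter: "letter l \<in> qsh_sub q"
| add: "u \<in> qsh_sub q \<Longrightarrow> v \<in> qsh_sub q \<Longrightarrow> u + v \<in> qsh_sub q"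
| scale: "v \<in> qsh_sub q \<Longrightarrow> scale c v \<in> qsh_sub q"
| shuffle: "u \<in> qsh_sub q \<Longrightarrow> v \<in> qsh_sub q \<Longrightarrow> qshuffle q u v \<in> qsh_sub q"

lemma subspace_qsh_sub: "free_alg.subspace (qsh_sub q)"
proof (rule free_alg.subspaceI)
  show "0 \<in> qsh_sub q"
    using qsh_sub.scale[OF qsh_sub.one, of 0] by simp
qed (auto intro: qsh_sub.intros)

definition X_map :: "'f::field \<Rightarrow> (xy, 'f) free_alg \<Rightarrow> (xy, 'f) free_alg"
  where "X_map q = alg_ext (\<lambda>l. case l of Lx \<Rightarrow> scale q (letter Lx) | Ly \<Rightarrow> letter Ly)"

definition K_map :: "'f::field \<Rightarrow> (xy, 'f) free_alg \<Rightarrow> (xy, 'f) free_alg"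
  where "K_map q = alg_ext (\<lambda>l. case l of Lx \<Rightarrow> scale (q powi 2) (letter Lx)
                                         | Ly \<Rightarrow> scale (q powi - 2) (letter Ly))"

lemma alg_ext_scale_comp:
  "alg_ext (\<lambda>l. scale (c l) (letter l)) (alg_ext (\<lambda>l. scale (d l) (letter l)) v)
     = alg_ext (\<lambda>l. scale (c l * d l) (letter l)) v"
proof (induction v rule: free_alg_induct)
  case (word e w)
  have "alg_ext (\<lambda>l. scale (c l) (letter l)) (prod_list (map (\<lambda>l. scale (d l) (letter l)) w))
      = prod_list (map (\<lambda>l. scale (c l * d l) (letter l)) w)"
    by (induction w) (simp_all add: alg_ext_one alg_ext_mult alg_ext_scale alg_ext_letter mult.commute)
  then show ?case by (simp add: single_conv_word alg_ext_scale alg_ext_word)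
qed (simp add: alg_ext_add)

lemma alg_ext_letter_id: "alg_ext letter v = v"
proof (induction v rule: free_alg_induct)
  case (word e w)
  have *: "prod_list (map letter w) = word w"
    by (induction w) (simp_all add: word_Nil letter_def flip: word_append)
  show ?case by (simp add: alg_ext_scale alg_ext_word *)
qed (simp add: alg_ext_add)

lemma bij_alg_ext_scale:
  assumes "\<And>l. c l \<noteq> 0"
  shows "bij (alg_ext (\<lambda>l. scale (c l) (letter l)))"
  by (rule o_bij[where g = "alg_ext (\<lambda>l. scale (inverse (c l)) (letter l))"])
     (simp_all add: fun_eq_iff alg_ext_scale_comp assms alg_ext_letter_id)

lemma bij_X_map: "q \<noteq> 0 \<Longrightarrow> bij (X_map q)"
proof -
  assume "q \<noteq> 0"
  have "X_map q = alg_ext (\<lambda>l. scale (case l of Lx \<Rightarrow> q | Ly \<Rightarrow> 1) (letter l))"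
    unfolding X_map_def by (intro arg_cong[where f = alg_ext] ext) (simp split: xy.split)
  with \<open>q \<noteq> 0\<close> show ?thesis by (auto intro!: bij_alg_ext_scale split: xy.splits)
qed

lemma bij_K_map: "q \<noteq> 0 \<Longrightarrow> bij (K_map q)"
proof -
  assume "q \<noteq> 0"
  have "K_map q = alg_ext (\<lambda>l. scale (case l of Lx \<Rightarrow> q powi 2 | Ly \<Rightarrow> q powi - 2) (letter l))"
    unfolding K_map_def by (intro arg_cong[where f = alg_ext] ext) (simp split: xy.split)
  with \<open>q \<noteq> 0\<close> show ?thesis by (auto intro!: bij_alg_ext_scale split: xy.splits)
qed

text \<open>The notation \<open>inv\<close> is taken by \<^theory>\<open>HOL-Algebra.Group\<close>.\<close>

definition X_inv :: "'f::field \<Rightarrow> (xy, 'f) free_alg \<Rightarrow> (xy, 'f) free_alg"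
  where "X_inv q = inv_into UNIV (X_map q)"

definition K_inv :: "'f::field \<Rightarrow> (xy, 'f) free_alg \<Rightarrow> (xy, 'f) free_alg"
  where "K_inv q = inv_into UNIV (K_map q)"

definition del_last :: "xy \<Rightarrow> (xy, 'f::field) free_alg \<Rightarrow> (xy, 'f) free_alg"
  where "del_last l = lin_ext (\<lambda>w. if w \<noteq> [] \<and> last w = l then word (butlast w) else 0)"

definition Astar_R :: "(xy, 'f::field) free_alg \<Rightarrow> (xy, 'f) free_alg"
  where "Astar_R = del_last Lx"
definition Bstar_R :: "(xy, 'f::field) free_alg \<Rightarrow> (xy, 'f) free_alg"
  where "Bstar_R = del_last Ly"
definition A_l :: "'f::field \<Rightarrow> (xy, 'f) free_alg \<Rightarrow> (xy, 'f) free_alg"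
  where "A_l q v = qshuffle q (letter Lx) v"
definition B_l :: "'f::field \<Rightarrow> (xy, 'f) free_alg \<Rightarrow> (xy, 'f) free_alg"
  where "B_l q v = qshuffle q (letter Ly) v"
definition A_r :: "'f::field \<Rightarrow> (xy, 'f) free_alg \<Rightarrow> (xy, 'f) free_alg"
  where "A_r q v = qshuffle q v (letter Lx)"
definition B_r :: "'f::field \<Rightarrow> (xy, 'f) free_alg \<Rightarrow> (xy, 'f) free_alg"
  where "B_r q v = qshuffle q v (letter Ly)"


section \<open>Algebras and their modules\<close>

text \<open>
  \<^locale>\<open>algebra\<close> and \<^locale>\<open>module\<close> cover commutative rings only, so associative algebras over
  a field and their left modules are introduced here.  The scalars form a type of class
  \<^class>\<open>field\<close>.  The module is a subspace \<open>W\<close> of an ambient vector space with scalar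
  multiplication \<open>sm\<close>.
\<close>

locale assoc_algebra = ring A for A :: "('f::field, 'a) module" (structure) +
  assumes smult_closed: "a \<in> carrier A \<Longrightarrow> c \<odot> a \<in> carrier A"
    and smult_add_right: "a \<in> carrier A \<Longrightarrow> b \<in> carrier A \<Longrightarrow> c \<odot> (a \<oplus> b) = c \<odot> a \<oplus> c \<odot> b"
    and smult_add_left: "a \<in> carrier A \<Longrightarrow> (c + d) \<odot> a = c \<odot> a \<oplus> d \<odot> a"
    and smult_assoc: "a \<in> carrier A \<Longrightarrow> (c * d) \<odot> a = c \<odot> (d \<odot> a)"
    and smult_one: "a \<in> carrier A \<Longrightarrow> 1 \<odot> a = a"
    and smult_mult_left: "a \<in> carrier A \<Longrightarrow> b \<in> carrier A \<Longrightarrow> c \<odot> (a \<otimes> b) = (c \<odot> a) \<otimes> b"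
    and smult_mult_right: "a \<in> carrier A \<Longrightarrow> b \<in> carrier A \<Longrightarrow> c \<odot> (a \<otimes> b) = a \<otimes> (c \<odot> b)"

locale left_module = assoc_algebra A + V: vector_space sm
  for A :: "('f::field, 'a) module" (structure)
    and sm :: "'f \<Rightarrow> 'v::ab_group_add \<Rightarrow> 'v" +
  fixes W :: "'v set" and act :: "'a \<Rightarrow> 'v \<Rightarrow> 'v"
  assumes subspace: "V.subspace W"
    and act_closed: "a \<in> carrier A \<Longrightarrow> v \<in> W \<Longrightarrow> act a v \<in> W"
    and act_add: "a \<in> carrier A \<Longrightarrow> v \<in> W \<Longrightarrow> w \<in> W \<Longrightarrow> act a (v + w) = act a v + act a w"
    and act_scale: "a \<in> carrier A \<Longrightarrow> v \<in> W \<Longrightarrow> act a (sm c v) = sm c (act a v)"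
    and add_act: "a \<in> carrier A \<Longrightarrow> b \<in> carrier A \<Longrightarrow> v \<in> W \<Longrightarrow> act (a \<oplus> b) v = act a v + act b v"
    and smult_act: "a \<in> carrier A \<Longrightarrow> v \<in> W \<Longrightarrow> act (c \<odot> a) v = sm c (act a v)"
    and mult_act: "a \<in> carrier A \<Longrightarrow> b \<in> carrier A \<Longrightarrow> v \<in> W \<Longrightarrow> act (a \<otimes> b) v = act a (act b v)"
    and one_act: "v \<in> W \<Longrightarrow> act \<one> v = v"


section \<open>Algebras given by generators and relations\<close>

abbreviation rel_ideal :: "('l, 'f::field) free_alg set \<Rightarrow> ('l, 'f) free_alg set"
  where "rel_ideal R \<equiv> genideal ring_of_type_algebra R"

definition presented :: "('l, 'f::field) free_alg set \<Rightarrow> ('f, ('l, 'f) free_alg set) module"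
  where "presented R = ring.extend (ring_of_type_algebra Quot rel_ideal R)
           (module.fields (\<lambda>c C. \<Union>a\<in>C. rel_ideal R +>\<^bsub>ring_of_type_algebra\<^esub> scale c a))"

lemma ring_of_type_algebra_ring_1: "ring (ring_of_type_algebra :: 'a::ring_1 ring)"
proof -
  have "\<exists>y. x + y = 0" for x :: 'a
    using add.right_inverse by blast
  then show ?thesis
    unfolding ring_of_type_algebra_def using add.right_inverse
    by unfold_locales (auto simp: algebra_simps Units_def)
qed

lemma ring_of_type_algebra_simps [simp]:
  "carrier ring_of_type_algebra = UNIV"
  "a \<otimes>\<^bsub>ring_of_type_algebra\<^esub> b = a * b"
  "a \<oplus>\<^bsub>ring_of_type_algebra\<^esub> b = a + b"
  "\<one>\<^bsub>ring_of_type_algebra\<^esub> = 1"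
  "\<zero>\<^bsub>ring_of_type_algebra\<^esub> = 0"
  by (simp_all add: ring_of_type_algebra_def)

lemma ideal_rel_ideal: "ideal (rel_ideal R) ring_of_type_algebra"
  by (rule ring.genideal_ideal[OF ring_of_type_algebra_ring_1]) simp

lemma scale_rel_ideal: "a \<in> rel_ideal R \<Longrightarrow> scale c a \<in> rel_ideal R"
  using ideal.I_l_closed[OF ideal_rel_ideal, of a R "scale c 1"]
  by (simp flip: scale_mult_left)

lemma presented_simps:
  "carrier (presented R) = carrier (ring_of_type_algebra Quot rel_ideal R)"
  "A \<otimes>\<^bsub>presented R\<^esub> B = A \<otimes>\<^bsub>ring_of_type_algebra Quot rel_ideal R\<^esub> B"
  "A \<oplus>\<^bsub>presented R\<^esub> B = A \<oplus>\<^bsub>ring_of_type_algebra Quot rel_ideal R\<^esub> B"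
  "\<one>\<^bsub>presented R\<^esub> = \<one>\<^bsub>ring_of_type_algebra Quot rel_ideal R\<^esub>"
  "\<zero>\<^bsub>presented R\<^esub> = \<zero>\<^bsub>ring_of_type_algebra Quot rel_ideal R\<^esub>"
  by (simp_all add: presented_def ring.defs module.defs)

lemma presented_smult:
  "c \<odot>\<^bsub>presented R\<^esub> (rel_ideal R +>\<^bsub>ring_of_type_algebra\<^esub> a)
     = rel_ideal R +>\<^bsub>ring_of_type_algebra\<^esub> scale c a"
proof -
  interpret ideal "rel_ideal R" ring_of_type_algebra by (rule ideal_rel_ideal)
  have "rel_ideal R +>\<^bsub>ring_of_type_algebra\<^esub> scale c b
      = rel_ideal R +>\<^bsub>ring_of_type_algebra\<^esub> scale c a"
    if "b \<in> rel_ideal R +>\<^bsub>ring_of_type_algebra\<^esub> a" for b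
  proof (rule a_repr_independence[symmetric])
    from that obtain h where "h \<in> rel_ideal R" "b = h + a"
      by (auto simp: a_r_coset_def')
    then show "scale c b \<in> rel_ideal R +>\<^bsub>ring_of_type_algebra\<^esub> scale c a"
      using scale_rel_ideal[of h R c]
      by (auto simp: a_r_coset_def' free_alg.scale_right_distrib)
    show "subgroup (rel_ideal R) (add_monoid ring_of_type_algebra)"
      by (rule a_subgroup)
  qed simp
  moreover have "a \<in> rel_ideal R +>\<^bsub>ring_of_type_algebra\<^esub> a"
    by (rule a_rcos_self) simp
  ultimately have
    "(\<Union>b \<in> rel_ideal R +>\<^bsub>ring_of_type_algebra\<^esub> a. rel_ideal R +>\<^bsub>ring_of_type_algebra\<^esub> scale c b)
       = rel_ideal R +>\<^bsub>ring_of_type_algebra\<^esub> scale c a"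
    by (intro UN_constant_eq) blast+
  then show ?thesis
    by (simp add: presented_def ring.defs module.defs)
qed

lemma assoc_algebra_presented: "assoc_algebra (presented R)"
proof -
  interpret ideal "rel_ideal R" ring_of_type_algebra by (rule ideal_rel_ideal)
  interpret Q: ring "ring_of_type_algebra Quot rel_ideal R" by (rule quotient_is_ring)
  let ?c = "\<lambda>a. rel_ideal R +>\<^bsub>ring_of_type_algebra\<^esub> a"
  have carrier: "carrier (presented R) = range ?c"
    by (auto simp: presented_simps FactRing_def A_RCOSETS_def')
  have add: "?c a \<oplus>\<^bsub>presented R\<^esub> ?c b = ?c (a + b)" for a b
    using a_rcos_sum[of a b] by (simp add: presented_simps) (simp add: FactRing_def)
  have mult: "?c a \<otimes>\<^bsub>presented R\<^esub> ?c b = ?c (a * b)" for a b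
    using rcoset_mult_add[of a b] by (simp add: presented_simps) (simp add: FactRing_def)
  have ring: "ring (presented R)"
  proof (rule ringI)
    show "abelian_group (presented R)"
      by (rule abelian_groupI)
         (auto simp: presented_simps Q.a_ac intro: Q.add.l_inv_ex)
    show "Group.monoid (presented R)"
      by (rule monoidI) (auto simp: presented_simps Q.m_assoc)
  qed (auto simp: presented_simps Q.l_distr Q.r_distr)
  show ?thesis
    by (intro assoc_algebra.intro ring assoc_algebra_axioms.intro)
       (auto simp: carrier presented_smult add mult free_alg.scale_right_distrib
         free_alg.scale_left_distrib simp flip: scale_mult_left scale_mult_right)
qed

definition presented_gen :: "('l, 'f::field) free_alg set \<Rightarrow> 'l \<Rightarrow> ('l, 'f) free_alg set"
  where "presented_gen R l = rel_ideal R +>\<^bsub>ring_of_type_algebra\<^esub> letter l"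


section \<open>The quantum affine algebra\<close>

datatype node = N0 | N1

datatype uq_letter = gK node | gKinv node | gD | gDinv | gE node | gF node

definition cartan :: "node \<Rightarrow> node \<Rightarrow> int"
  where "cartan i j = (if i = j then 2 else - 2)"

definition commutator :: "('l, 'f::field) free_alg \<Rightarrow> ('l, 'f) free_alg \<Rightarrow> ('l, 'f) free_alg"
  where "commutator a b = a * b - b * a"

definition qcommutator ::
    "'f::field \<Rightarrow> ('l, 'f) free_alg \<Rightarrow> ('l, 'f) free_alg \<Rightarrow> ('l, 'f) free_alg"
  where "qcommutator p a b = scale p (a * b) - scale (inverse p) (b * a)"

text \<open>A relation \<open>a = b\<close> is recorded as the element \<open>a - b\<close>.\<close>

inductive_set uq_relators :: "'f::field \<Rightarrow> (uq_letter, 'f) free_alg set" for q where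
  "letter (gK i) * letter (gKinv i) - 1 \<in> uq_relators q"
| "letter (gKinv i) * letter (gK i) - 1 \<in> uq_relators q"
| "letter gD * letter gDinv - 1 \<in> uq_relators q"
| "letter gDinv * letter gD - 1 \<in> uq_relators q"
| "commutator (letter (gK i)) (letter (gK j)) \<in> uq_relators q"
| "commutator (letter gD) (letter (gK i)) \<in> uq_relators q"
| "letter (gK i) * letter (gE j) * letter (gKinv i) - scale (q powi cartan i j) (letter (gE j))
     \<in> uq_relators q"
| "letter (gK i) * letter (gF j) * letter (gKinv i) - scale (q powi - cartan i j) (letter (gF j))
     \<in> uq_relators q"
| "letter gD * letter (gE N0) * letter gDinv - scale q (letter (gE N0)) \<in> uq_relators q"
| "letter gD * letter (gF N0) * letter gDinv - scale (inverse q) (letter (gF N0)) \<in> uq_relators q"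
| "commutator (letter gD) (letter (gE N1)) \<in> uq_relators q"
| "commutator (letter gD) (letter (gF N1)) \<in> uq_relators q"
| "commutator (letter (gE i)) (letter (gF j))
     - (if i = j then scale (1 / (q - inverse q)) (letter (gK i) - letter (gKinv i)) else 0)
     \<in> uq_relators q"
| "i \<noteq> j \<Longrightarrow>
     commutator (letter (gE i))
       (qcommutator (inverse q) (letter (gE i)) (qcommutator q (letter (gE i)) (letter (gE j))))
     \<in> uq_relators q"
| "i \<noteq> j \<Longrightarrow>
     commutator (letter (gF i))
       (qcommutator (inverse q) (letter (gF i)) (qcommutator q (letter (gF i)) (letter (gF j))))
     \<in> uq_relators q"

definition Uq :: "'f::field \<Rightarrow> ('f, (uq_letter, 'f) free_alg set) module"
  where "Uq q = presented (uq_relators q)"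

definition uq_gen :: "'f::field \<Rightarrow> uq_letter \<Rightarrow> (uq_letter, 'f) free_alg set"
  where "uq_gen q = presented_gen (uq_relators q)"

end

theory Submission
  imports Defs
begin

text \<open>
  Write \<open>D l\<close> for the deletion of a last letter \<open>l\<close>.  A vector is determined by its empty-word
  coefficient and its images under \<open>D Lx\<close>, \<open>D Ly\<close>, and \<open>D l\<close> is a twisted derivation of the
  shuffle product.  Hence an identity holds as soon as both sides have the same empty-word
  coefficient and interact in the same way with the \<open>D l\<close>; this yields associativity of the product.
  The relation for \<open>[E\<^sub>i, F\<^sub>j]\<close> is the Leibniz rule, and it implies that the \<open>q\<close>-Serre
  expression in the \<open>F\<^sub>i\<close> commutes with every \<open>D l\<close>; since it raises the degree, it vanishes on
  the whole space.  The \<open>q\<close>-Serre expression in the \<open>E\<^sub>i\<close> commutes with left multiplication by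
  letters and kills the empty word, so by associativity it vanishes on the subalgebra generated by
  the letters (but not on the whole space).
\<close>

section \<open>Linear maps and word coefficients\<close>

lemma linearI:
  assumes "\<And>u v. T (u + v) = T u + T v" "\<And>c v. T (scale c v) = scale c (T v)"
  shows "Vector_Spaces.linear scale scale T"
  using assms by unfold_locales auto

lemma
  assumes "Vector_Spaces.linear scale scale T"
  shows linear_plus: "T (u + v) = T u + T v"
    and linear_diff: "T (u - v) = T u - T v"
    and linear_minus: "T (- u) = - T u"
    and linear_scale: "T (scale c u) = scale c (T u)"
    and linear_zero: "T 0 = 0"
proof -
  interpret Vector_Spaces.linear scale scale T by fact
  show "T (u + v) = T u + T v" "T (u - v) = T u - T v" "T (- u) = - T u"
    "T (scale c u) = scale c (T u)" "T 0 = 0"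
    by (simp_all add: add diff neg scale zero)
qed

lemmas linear_simps = linear_plus linear_diff linear_minus linear_scale linear_zero

lemma linear_lin_ext: "Vector_Spaces.linear scale scale (lin_ext f)"
  by (simp add: linearI lin_ext_add lin_ext_scale)

lemma linear_alg_ext: "Vector_Spaces.linear scale scale (alg_ext f)"
  by (simp add: linearI alg_ext_add alg_ext_scale)

lemma lookup_word: "Poly_Mapping.lookup (word w) t = (if w = t then 1 else 0)"
  by (simp add: word_def lookup_single when_def)

section \<open>Modules over presented algebras\<close>

text \<open>The left action of the free algebra extending \<open>g\<close>; \<open>foldr\<close>
  lets the last letter act first, so concatenation acts by composition.\<close>

definition word_action ::
    "('l \<Rightarrow> ('m, 'f) free_alg \<Rightarrow> ('m, 'f) free_alg) \<Rightarrow> ('l, 'f::field) free_alg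
      \<Rightarrow> ('m, 'f) free_alg \<Rightarrow> ('m, 'f) free_alg"
  where "word_action g a v = lin_ext (\<lambda>w. foldr g w v) a"

lemma
  shows word_action_plus: "word_action g (a + b) v = word_action g a v + word_action g b v"
    and word_action_diff: "word_action g (a - b) v = word_action g a v - word_action g b v"
    and word_action_scale: "word_action g (scale c a) v = scale c (word_action g a v)"
    and word_action_zero: "word_action g 0 v = 0"
    and word_action_word: "word_action g (word w) v = foldr g w v"
    and word_action_letter: "word_action g (letter l) v = g l v"
    and word_action_one: "word_action g 1 v = v"
  unfolding word_action_def
  by (simp_all add: linear_simps[OF linear_lin_ext] letter_def flip: word_Nil)

lemma linear_foldr:
  assumes "\<And>l. Vector_Spaces.linear scale scale (g l)"
  shows "Vector_Spaces.linear scale scale (foldr g w)"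
  by (induction w) (auto intro!: linearI simp: linear_simps[OF assms] linear_simps)

lemma linear_word_action:
  assumes "\<And>l. Vector_Spaces.linear scale scale (g l)"
  shows "Vector_Spaces.linear scale scale (word_action g a)"
proof (rule linearI)
  fix u v c
  show "word_action g a (u + v) = word_action g a u + word_action g a v"
    by (induction a rule: free_alg_induct)
       (simp_all add: word_action_plus word_action_scale word_action_word
         linear_simps[OF linear_foldr[OF assms]] free_alg.scale_right_distrib)
  show "word_action g a (scale c v) = scale c (word_action g a v)"
    by (induction a rule: free_alg_induct)
       (simp_all add: word_action_plus word_action_scale word_action_word
         linear_simps[OF linear_foldr[OF assms]] free_alg.scale_right_distrib mult.commute)
qed

lemma word_action_mult:
  assumes "\<And>l. Vector_Spaces.linear scale scale (g l)"
  shows "word_action g (a * b) v = word_action g a (word_action g b v)"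
proof (induction a rule: free_alg_induct)
  case (word c w)
  have "word_action g (word w * b) v = word_action g (word w) (word_action g b v)"
    by (induction b rule: free_alg_induct)
       (simp_all add: distrib_left word_action_plus word_action_scale word_action_word
         linear_simps[OF linear_foldr[OF assms]] flip: scale_mult_right word_append)
  then show ?case
    by (simp add: word_action_scale flip: scale_mult_left)
qed (simp add: distrib_right word_action_plus)

lemma word_action_closed:
  assumes "free_alg.subspace W" "\<And>l v. v \<in> W \<Longrightarrow> g l v \<in> W" "v \<in> W"
  shows "word_action g a v \<in> W"
proof (induction a rule: free_alg_induct)
  case (word c w)
  have "foldr g w v \<in> W"
    by (induction w) (use assms in auto)
  then show ?case
    using assms(1) by (simp add: word_action_scale word_action_word free_alg.subspace_scale)
qed (use assms(1) in \<open>auto simp: word_action_plus free_alg.subspace_add\<close>)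

text \<open>The annihilator of \<open>W\<close> is a two-sided ideal, so once it contains
  \<open>R\<close> it contains \<open>rel_ideal R\<close> and the action passes to cosets. Relations
  are required on \<open>W\<close> only, since the q-Serre relation in the \<open>E\<close>
  generators is available only on the subalgebra.\<close>

lemma left_module_presented:
  fixes g :: "'l \<Rightarrow> ('m, 'f::field) free_alg \<Rightarrow> ('m, 'f) free_alg"
  assumes lin_g: "\<And>l. Vector_Spaces.linear scale scale (g l)"
    and sub: "free_alg.subspace W"
    and closed: "\<And>l v. v \<in> W \<Longrightarrow> g l v \<in> W"
    and rel: "\<And>r v. r \<in> R \<Longrightarrow> v \<in> W \<Longrightarrow> word_action g r v = 0"
  shows "\<exists>act. left_module (presented R) scale W act \<and>
           (\<forall>l. \<forall>v\<in>W. act (presented_gen R l) v = g l v)"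
proof -
  let ?F = "ring_of_type_algebra :: ('l, 'f) free_alg ring"
  let ?c = "\<lambda>a. rel_ideal R +>\<^bsub>?F\<^esub> a"
  \<comment> \<open>A coset acts through a chosen representative; the fact \<open>act\<close> below
    shows that on \<open>W\<close> the choice does not matter.\<close>
  let ?act = "\<lambda>C. word_action g (SOME a. ?c a = C)"
  interpret ideal "rel_ideal R" ?F by (rule ideal_rel_ideal)
  note lin_act = linear_simps[OF linear_word_action[OF lin_g]]
  have carrier: "carrier (presented R) = range ?c"
    by (auto simp: presented_simps FactRing_def A_RCOSETS_def')
  have add: "?c a \<oplus>\<^bsub>presented R\<^esub> ?c b = ?c (a + b)" for a b
    using a_rcos_sum[of a b] by (simp add: presented_simps) (simp add: FactRing_def)
  have mult: "?c a \<otimes>\<^bsub>presented R\<^esub> ?c b = ?c (a * b)" for a b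
    using rcoset_mult_add[of a b] by (simp add: presented_simps) (simp add: FactRing_def)
  \<comment> \<open>For multiplication on the right, stability of \<open>W\<close> enters: the right
    factor acts first and must stay in \<open>W\<close>.\<close>
  have "ideal {r. \<forall>v\<in>W. word_action g r v = 0} ?F"
  proof (rule idealI)
    show "subgroup {r. \<forall>v\<in>W. word_action g r v = 0} (add_monoid ?F)"
    proof (rule group.subgroupI)
      show "Group.group (add_monoid ?F)"
        by (rule a_group)
      fix r assume r: "r \<in> {r. \<forall>v\<in>W. word_action g r v = 0}"
      have "\<ominus>\<^bsub>?F\<^esub> r = - r"
        by (rule minus_equality) auto
      moreover have "word_action g (- r) v = - word_action g r v" for v
        using word_action_diff[of g 0 r v] by (simp add: word_action_zero)
      ultimately show "inv\<^bsub>add_monoid ?F\<^esub> r \<in> {r. \<forall>v\<in>W. word_action g r v = 0}"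
        using r by (simp add: a_inv_def)
    qed (auto simp: word_action_plus intro: exI[of _ 0] word_action_zero)
  qed (auto simp: word_action_mult[OF lin_g] lin_act ring_of_type_algebra_ring_1 word_action_closed[OF sub closed])
  moreover have "R \<subseteq> {r. \<forall>v\<in>W. word_action g r v = 0}"
    using rel by auto
  ultimately have ideal: "rel_ideal R \<subseteq> {r. \<forall>v\<in>W. word_action g r v = 0}"
    by (rule genideal_minimal)
  have act: "?act (?c a) v = word_action g a v" if "v \<in> W" for a v
  proof -
    define b where "b = (SOME b. ?c b = ?c a)"
    have "?c b = ?c a"
      unfolding b_def by (rule someI[of _ a]) simp
    moreover have "b \<in> ?c b"
      by (rule a_rcos_self) simp
    ultimately obtain h where "h \<in> rel_ideal R" "b = h + a"
      by (auto simp: a_r_coset_def')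
    then show ?thesis
      using ideal that unfolding b_def[symmetric] by (auto simp: word_action_plus)
  qed
  have one: "\<one>\<^bsub>presented R\<^esub> = ?c 1"
    by (simp add: presented_simps) (simp add: FactRing_def)
  have "left_module (presented R) scale W ?act"
    by (intro left_module.intro left_module_axioms.intro assoc_algebra_presented
        free_alg.vector_space_axioms sub)
       (auto simp: carrier act add mult one presented_smult lin_act word_action_plus
         word_action_scale word_action_one word_action_mult[OF lin_g]
         word_action_closed[OF sub closed] free_alg.subspace_add[OF sub]
         free_alg.subspace_scale[OF sub])
  moreover have "?act (presented_gen R l) v = g l v" if "v \<in> W" for l v
    using that by (simp add: presented_gen_def act word_action_letter)
  ultimately show ?thesis by blast
qed

section \<open>The \<open>q\<close>-Serre expression\<close>

text \<open>The iterated q-commutator multiplied out; the coefficient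
  \<open>q\<^sup>2 + 1 + inverse (q\<^sup>2)\<close> is the q-integer [3].\<close>

definition serre ::
    "'f::field \<Rightarrow> (('l, 'f) free_alg \<Rightarrow> ('l, 'f) free_alg) \<Rightarrow> (('l, 'f) free_alg \<Rightarrow> ('l, 'f) free_alg)
      \<Rightarrow> ('l, 'f) free_alg \<Rightarrow> ('l, 'f) free_alg"
  where "serre q a b v =
    a (a (a (b v))) - scale (q\<^sup>2 + 1 + inverse (q\<^sup>2)) (a (a (b (a v))))
      + scale (q\<^sup>2 + 1 + inverse (q\<^sup>2)) (a (b (a (a v)))) - b (a (a (a v)))"

lemma word_action_serre:
  assumes "q \<noteq> 0" "\<And>l. Vector_Spaces.linear scale scale (g l)"
  shows "word_action g (commutator (letter i)
           (qcommutator (inverse q) (letter i) (qcommutator q (letter i) (letter j)))) v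
         = serre q (g i) (g j) v"
proof -
  have "word_action g (commutator (letter i)
           (qcommutator (inverse q) (letter i) (qcommutator q (letter i) (letter j)))) v
      = g i (scale (inverse q) (g i (scale q (g i (g j v)) - scale (inverse q) (g j (g i v))))
          - scale q (scale q (g i (g j (g i v))) - scale (inverse q) (g j (g i (g i v)))))
        - (scale (inverse q) (g i (scale q (g i (g j (g i v))) - scale (inverse q) (g j (g i (g i v)))))
          - scale q (scale q (g i (g j (g i (g i v)))) - scale (inverse q) (g j (g i (g i (g i v))))))"
    by (simp only: commutator_def qcommutator_def word_action_diff word_action_scale
        word_action_mult[OF assms(2)] word_action_letter inverse_inverse_eq)
  also have "\<dots> = serre q (g i) (g j) v"
    using assms(1)
    by (intro poly_mapping_eqI)
       (simp add: serre_def linear_simps[OF assms(2)] lookup_add lookup_minus field_simps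
         power2_eq_square)
  finally show ?thesis .
qed

lemma linear_serre:
  assumes "Vector_Spaces.linear scale scale a" "Vector_Spaces.linear scale scale b"
  shows "Vector_Spaces.linear scale scale (serre q a b)"
  by (rule linearI)
     (simp_all add: serre_def linear_simps[OF assms(1)] linear_simps[OF assms(2)]
       free_alg.scale_right_distrib free_alg.scale_right_diff_distrib mult.commute)

text \<open>Pushing every \<open>z\<close> to the right past \<open>a\<close> and \<open>b\<close>
  leaves multiples of \<open>a a b z\<close>, \<open>a b a z\<close> and \<open>b a a z\<close>,
  whose coefficients cancel. The terms in \<open>z'\<close> follow by exchanging \<open>q\<close>
  and \<open>inverse q\<close>.\<close>

lemma serre_commute_fst:
  assumes "q \<noteq> 0"
    and lin: "Vector_Spaces.linear scale scale a" "Vector_Spaces.linear scale scale b"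
      "Vector_Spaces.linear scale scale e"
    and e: "\<And>v. e (a v) = a (e v) + z v + z' v" "\<And>v. e (b v) = b (e v)"
    and z: "\<And>v. z (a v) = scale (q\<^sup>2) (a (z v))" "\<And>v. z (b v) = scale (inverse (q\<^sup>2)) (b (z v))"
    and z': "\<And>v. z' (a v) = scale (inverse (q\<^sup>2)) (a (z' v))" "\<And>v. z' (b v) = scale (q\<^sup>2) (b (z' v))"
  shows "e (serre q a b v) = serre q a b (e v)"
  using assms(1)
  by (intro poly_mapping_eqI)
     (simp add: serre_def linear_simps[OF lin(1)] linear_simps[OF lin(2)] linear_simps[OF lin(3)]
       e z z' lookup_add lookup_minus field_simps power2_eq_square)

text \<open>All four terms yield multiples of \<open>a a a z\<close>, with total 1 - [3]p + [3]p^2 -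
  p^3 = 0 for p = q^-2; likewise for \<open>z'\<close> with p = q^2.\<close>

lemma serre_commute_snd:
  assumes "q \<noteq> 0"
    and lin: "Vector_Spaces.linear scale scale a" "Vector_Spaces.linear scale scale b"
      "Vector_Spaces.linear scale scale e"
    and e: "\<And>v. e (a v) = a (e v)" "\<And>v. e (b v) = b (e v) + z v + z' v"
    and z: "\<And>v. z (a v) = scale (inverse (q\<^sup>2)) (a (z v))"
    and z': "\<And>v. z' (a v) = scale (q\<^sup>2) (a (z' v))"
  shows "e (serre q a b v) = serre q a b (e v)"
  using assms(1)
  by (intro poly_mapping_eqI)
     (simp add: serre_def linear_simps[OF lin(1)] linear_simps[OF lin(2)] linear_simps[OF lin(3)]
       e z z' lookup_add lookup_minus field_simps power2_eq_square)

section \<open>Deletion of the last letter and diagonal automorphisms\<close>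

lemma linear_del_last: "Vector_Spaces.linear scale scale (del_last l)"
  unfolding del_last_def by (rule linear_lin_ext)

lemmas del_last_simps = linear_simps[OF linear_del_last]

lemma del_last_word: "del_last l (word w) = (if w \<noteq> [] \<and> last w = l then word (butlast w) else 0)"
  by (simp add: del_last_def)

lemma del_last_one: "del_last l 1 = 0"
  by (simp add: del_last_word flip: word_Nil)

lemma del_last_letter: "del_last l (letter m) = (if l = m then 1 else 0)"
  by (simp add: del_last_word letter_def word_Nil)

lemma del_last_mult_letter: "del_last l (v * letter m) = (if l = m then v else 0)"
  by (induction v rule: free_alg_induct)
     (auto simp: distrib_right del_last_simps letter_def del_last_word
       simp flip: scale_mult_left word_append)

lemma lookup_del_last: "Poly_Mapping.lookup (del_last l v) w = Poly_Mapping.lookup v (w @ [l])"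
  by (induction v rule: free_alg_induct)
     (auto simp: del_last_simps del_last_word lookup_word lookup_add)

text \<open>Induction on words from the right. The hypothesis at \<open>t\<close> covers all
  arguments \<open>y\<close>, because the Leibniz rule changes the arguments.\<close>

lemma eq_by_del_last:
  assumes "\<And>x. Poly_Mapping.lookup (f x) [] = Poly_Mapping.lookup (g x) []"
    and "\<And>t x l. (\<And>y. Poly_Mapping.lookup (f y) t = Poly_Mapping.lookup (g y) t) \<Longrightarrow>
      Poly_Mapping.lookup (del_last l (f x)) t = Poly_Mapping.lookup (del_last l (g x)) t"
  shows "f x = g x"
proof (rule poly_mapping_eqI)
  show "Poly_Mapping.lookup (f x) t = Poly_Mapping.lookup (g x) t" for t
  proof (induction t arbitrary: x rule: rev_induct)
    case (snoc l t)
    show ?case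
      using assms(2)[OF snoc] by (simp only: lookup_del_last)
  qed (rule assms(1))
qed

text \<open>Common form of \<open>X_map\<close>, \<open>K_map\<close>, their inverses and
  \<open>weight\<close>; in particular these all commute.\<close>

definition diag :: "('l \<Rightarrow> 'f) \<Rightarrow> ('l, 'f::field) free_alg \<Rightarrow> ('l, 'f) free_alg"
  where "diag c = alg_ext (\<lambda>l. scale (c l) (letter l))"

lemma linear_diag: "Vector_Spaces.linear scale scale (diag c)"
  unfolding diag_def by (rule linear_alg_ext)

lemmas diag_simps = linear_simps[OF linear_diag]

lemma diag_diag: "diag c (diag d v) = diag (\<lambda>l. c l * d l) v"
  by (simp add: diag_def alg_ext_scale_comp)

lemma diag_one_fun: "diag (\<lambda>l. 1) v = v"
  by (simp add: diag_def alg_ext_letter_id)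

lemma diag_commute: "diag c (diag d v) = diag d (diag c v)"
  by (simp add: diag_diag mult.commute)

lemma diag_one: "diag c 1 = 1"
  by (simp add: diag_def alg_ext_one)

lemma diag_letter: "diag c (letter l) = scale (c l) (letter l)"
  by (simp add: diag_def alg_ext_letter)

lemma diag_word: "diag c (word w) = scale (\<Prod>l\<leftarrow>w. c l) (word w)"
proof (induction w)
  case (Cons l w)
  have "diag c (word (l # w)) = diag c (letter l) * diag c (word w)"
    by (simp add: diag_def letter_def flip: alg_ext_mult word_append)
  also have "\<dots> = scale (\<Prod>l\<leftarrow>l # w. c l) (letter l * word w)"
    by (simp add: Cons diag_letter mult.commute flip: scale_mult_left scale_mult_right)
  finally show ?case
    by (simp add: letter_def flip: word_append)
qed (simp add: word_Nil diag_one)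

lemma lookup_diag: "Poly_Mapping.lookup (diag c v) w = (\<Prod>l\<leftarrow>w. c l) * Poly_Mapping.lookup v w"
  by (induction v rule: free_alg_induct)
     (auto simp: diag_simps diag_word lookup_add algebra_simps lookup_word)

lemma del_last_diag: "del_last l (diag c v) = scale (c l) (diag c (del_last l v))"
  by (rule poly_mapping_eqI) (simp add: lookup_del_last lookup_diag)

section \<open>The \<open>q\<close>-shuffle product\<close>

lemma shuffle_words_Nil_right: "shuffle_words q u [] = word u"
  by (cases u) simp_all

lemma linear_qshuffle_left: "Vector_Spaces.linear scale scale (\<lambda>u. qshuffle q u v)"
  unfolding qshuffle_def by (rule linear_lin_ext)

lemma linear_qshuffle_right: "Vector_Spaces.linear scale scale (qshuffle q u)"
  by (rule linearI)
     (simp_all add: qshuffle_def lin_ext_add lin_ext_scale lin_ext_def[of _ u]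
       free_alg.scale_right_distrib sum.distrib free_alg.scale_sum_right mult.commute)

lemmas qshuffle_simps =
  linear_simps[OF linear_qshuffle_left] linear_simps[OF linear_qshuffle_right]

lemma qshuffle_word: "qshuffle q (word u) (word v) = shuffle_words q u v"
  by (simp add: qshuffle_def)

lemma qshuffle_one_left: "qshuffle q 1 v = v"
  by (induction v rule: free_alg_induct) (simp_all add: qshuffle_simps qshuffle_word flip: word_Nil)

lemma qshuffle_one_right: "qshuffle q v 1 = v"
  by (induction v rule: free_alg_induct)
     (simp_all add: qshuffle_simps qshuffle_word shuffle_words_Nil_right flip: word_Nil)

text \<open>Mirror image of the defining recursion, needed because deletion acts on last letters.
  Expanding at the first letters and applying the induction hypotheses at the last ones sorts the
  terms by both ends; the scalars agree because the form is symmetric.\<close>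

lemma shuffle_words_snoc:
  fixes q :: "'f::field"
  assumes "q \<noteq> 0"
  shows "shuffle_words q (u @ [a]) (v @ [b]) =
    shuffle_words q (u @ [a]) v * letter b
      + scale (\<Prod>c\<leftarrow>v @ [b]. q powi xy_form c a) (shuffle_words q u (v @ [b]) * letter a)"
proof -
  have word_Cons: "word (c # w) = (letter c * word w :: (xy, 'f) free_alg)" for c w
    by (simp add: letter_def flip: word_append)
  have word_snoc: "word (w @ [c]) = (word w * letter c :: (xy, 'f) free_alg)" for c w
    by (simp add: letter_def flip: word_append)
  have sym: "xy_form c d = xy_form d c" for c d
    by (simp add: xy_form_def)
  note simps = word_Cons word_snoc word_Nil shuffle_words_Nil_right power_int_add assms
    distrib_left distrib_right mult.assoc free_alg.scale_right_distrib
    scale_mult_left[symmetric] scale_mult_right[symmetric]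
  show ?thesis
  proof (induction u arbitrary: v)
    case Nil
    show ?case
    proof (induction v)
      case Nil
      show ?case by (simp add: simps sym[of a])
    next
      case (Cons d v)
      then show ?case by (simp add: simps sym[of a] mult_ac add_ac)
    qed
  next
    case (Cons c u)
    note IH = Cons.IH
    show ?case
    proof (induction v)
      case Nil
      show ?case using IH[of "[]"] by (simp add: simps sym[of a] mult_ac add_ac)
    next
      case (Cons d v)
      then show ?case
        using IH[of "d # v"] by (simp add: simps sym[of a] mult_ac add_ac)
    qed
  qed
qed

text \<open>The scalar a letter \<open>l\<close> picks up on its way past a word. For nonzero
  \<open>q\<close> this is \<open>K_map q\<close> at \<open>Lx\<close> and \<open>K_inv q\<close> at
  \<open>Ly\<close>.\<close>

definition weight :: "'f::field \<Rightarrow> xy \<Rightarrow> (xy, 'f) free_alg \<Rightarrow> (xy, 'f) free_alg"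
  where "weight q l = diag (\<lambda>c. q powi xy_form c l)"

text \<open>By bilinearity words suffice. There \<open>shuffle_words_snoc\<close> shows the last
  letter of each term: it comes from \<open>v\<close>, or from \<open>u\<close> after passing all of
  \<open>v\<close>.\<close>

lemma del_last_qshuffle:
  assumes "q \<noteq> 0"
  shows "del_last l (qshuffle q u v)
    = qshuffle q u (del_last l v) + qshuffle q (del_last l u) (weight q l v)"
proof (induction u rule: free_alg_induct)
  case (word c u)
  have "del_last l (shuffle_words q u w)
      = qshuffle q (word u) (del_last l (word w)) + qshuffle q (del_last l (word u)) (weight q l (word w))" for w
  proof (cases u rule: rev_cases)
    case Nil
    then show ?thesis
      by (simp add: word_Nil qshuffle_one_left del_last_one qshuffle_simps)
  next
    case u: (snoc u' a)
    show ?thesis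
    proof (cases w rule: rev_cases)
      case Nil
      then show ?thesis
        by (simp add: word_Nil qshuffle_one_right del_last_one qshuffle_simps
            shuffle_words_Nil_right weight_def diag_one)
    next
      case w: (snoc w' b)
      show ?thesis
        unfolding u w
        by (simp add: shuffle_words_snoc[OF assms] del_last_simps del_last_mult_letter
            del_last_word qshuffle_simps qshuffle_word weight_def diag_word del: map_append)
    qed
  qed
  then have "del_last l (qshuffle q (word u) v)
      = qshuffle q (word u) (del_last l v) + qshuffle q (del_last l (word u)) (weight q l v)"
    by (induction v rule: free_alg_induct)
       (simp_all add: qshuffle_simps del_last_simps qshuffle_word weight_def diag_simps
         free_alg.scale_right_distrib)
  then show ?case
    by (simp add: qshuffle_simps del_last_simps free_alg.scale_right_distrib)
qed (simp add: qshuffle_simps del_last_simps)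

lemma lookup_qshuffle_Nil:
  fixes q :: "'a::field"
  shows "Poly_Mapping.lookup (qshuffle q u v) [] = Poly_Mapping.lookup u [] * Poly_Mapping.lookup v []"
proof -
  have letter: "Poly_Mapping.lookup (letter l * w) [] = 0" for l and w :: "(xy, 'a) free_alg"
  proof (induction w rule: free_alg_induct)
    case (word c w)
    have "letter l * scale c (word w) = scale c (word (l # w) :: (xy, 'a) free_alg)"
      by (simp add: letter_def flip: scale_mult_right word_append)
    then show ?case by (simp add: lookup_word)
  qed (simp add: distrib_left lookup_add)
  have word: "Poly_Mapping.lookup (shuffle_words q u v) [] = (if u = [] \<and> v = [] then 1 else 0)" for u v
    by (cases u; cases v) (simp_all add: lookup_add letter lookup_word)
  have "Poly_Mapping.lookup (qshuffle q (word u) v) [] = (if u = [] then Poly_Mapping.lookup v [] else 0)" for u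
    by (induction v rule: free_alg_induct)
       (simp_all add: qshuffle_simps qshuffle_word word lookup_add lookup_word)
  then show ?thesis
    by (induction u rule: free_alg_induct)
       (simp_all add: qshuffle_simps lookup_add lookup_word distrib_right)
qed

text \<open>Moving \<open>del_last l\<close> past \<open>diag c\<close> costs the factor
  \<open>c l\<close> on either side, and \<open>diag c\<close> commutes with \<open>weight\<close>,
  so both sides obey the same recursion.\<close>

lemma diag_qshuffle:
  assumes "q \<noteq> 0"
  shows "diag c (qshuffle q u v) = qshuffle q (diag c u) (diag c v)"
proof -
  \<comment> \<open>\<open>eq_by_del_last\<close> compares functions of one argument, hence the
    pair.\<close>
  have "(\<lambda>(u, v). diag c (qshuffle q u v)) p = (\<lambda>(u, v). qshuffle q (diag c u) (diag c v)) p" for p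
  proof (rule eq_by_del_last[of "\<lambda>(u, v). diag c (qshuffle q u v)"
        "\<lambda>(u, v). qshuffle q (diag c u) (diag c v)"], goal_cases)
    case (1 p)
    show ?case by (cases p) (simp add: lookup_diag lookup_qshuffle_Nil)
  next
    case (2 t p l)
    have IH: "Poly_Mapping.lookup (diag c (qshuffle q u v)) t = Poly_Mapping.lookup (qshuffle q (diag c u) (diag c v)) t" for u v
      using 2[of "(u, v)"] by simp
    show ?case
      by (cases p) (simp add: del_last_diag del_last_qshuffle[OF assms] diag_simps qshuffle_simps
          lookup_add IH weight_def diag_commute[of c] algebra_simps)
  qed
  from this[of "(u, v)"] show ?thesis by simp
qed

text \<open>Being diagonal, \<open>weight q l\<close> is multiplicative for the shuffle product;
  both bracketings therefore satisfy the same three-term Leibniz rule.\<close>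

lemma qshuffle_assoc:
  assumes "q \<noteq> 0"
  shows "qshuffle q (qshuffle q u v) w = qshuffle q u (qshuffle q v w)"
proof -
  have "(\<lambda>(u, v, w). qshuffle q (qshuffle q u v) w) p
      = (\<lambda>(u, v, w). qshuffle q u (qshuffle q v w)) p" for p
  proof (rule eq_by_del_last[of "\<lambda>(u, v, w). qshuffle q (qshuffle q u v) w"
        "\<lambda>(u, v, w). qshuffle q u (qshuffle q v w)"], goal_cases)
    case (1 p)
    show ?case by (cases p) (simp add: lookup_qshuffle_Nil)
  next
    case (2 t p l)
    have IH: "Poly_Mapping.lookup (qshuffle q (qshuffle q u v) w) t = Poly_Mapping.lookup (qshuffle q u (qshuffle q v w)) t" for u v w
      using 2[of "(u, v, w)"] by simp
    show ?case
      by (cases p) (simp add: del_last_qshuffle[OF assms] qshuffle_simps lookup_add IH weight_def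
          diag_qshuffle[OF assms])
  qed
  from this[of "(u, v, w)"] show ?thesis by simp
qed

lemma weight_letter: "weight q l (letter m) = scale (q powi xy_form m l) (letter m)"
  by (simp add: weight_def diag_letter)

lemma linear_weight: "Vector_Spaces.linear scale scale (weight q l)"
  unfolding weight_def by (rule linear_diag)

lemmas weight_simps = linear_simps[OF linear_weight]

section \<open>The subalgebra generated by the letters\<close>

lemma diag_qsh_sub:
  assumes "q \<noteq> 0" "v \<in> qsh_sub q"
  shows "diag c v \<in> qsh_sub q"
  using assms(2)
  by induction
     (auto simp: diag_one diag_letter diag_simps diag_qshuffle[OF assms(1)] intro: qsh_sub.intros)

lemma del_last_qsh_sub:
  assumes "q \<noteq> 0" "v \<in> qsh_sub q"
  shows "del_last l v \<in> qsh_sub q"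
  using assms(2)
proof induction
  case (letter m)
  show ?case
    using free_alg.subspace_0[OF subspace_qsh_sub[of q]]
    by (simp add: del_last_letter qsh_sub.one)
next
  case (shuffle u v)
  then show ?case
    unfolding del_last_qshuffle[OF assms(1)] weight_def
    by (intro qsh_sub.add qsh_sub.shuffle diag_qsh_sub[OF assms(1)])
qed (auto simp: del_last_one del_last_simps free_alg.subspace_0[OF subspace_qsh_sub]
       intro: qsh_sub.add qsh_sub.scale)

lemma serre_del_last_qsh_sub:
  assumes "q \<noteq> 0" "l \<noteq> m" "v \<in> qsh_sub q"
  shows "serre q (del_last l) (del_last m) v = 0"
proof -
  let ?S = "serre q (del_last l) (del_last m)"
  note linear_S = linear_serre[OF linear_del_last linear_del_last, of q l m]
  have weight_del_last: "weight q k (del_last n v) = scale (q powi - xy_form n k) (del_last n (weight q k v))" for k n v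
    using assms(1) by (simp add: weight_def del_last_diag power_int_minus)
  have del_last_left: "del_last n (qshuffle q (letter k) v)
      = qshuffle q (letter k) (del_last n v) + (if n = k then weight q k v else 0)" for k n v
    by (simp add: del_last_qshuffle[OF assms(1)] del_last_letter qshuffle_one_left qshuffle_simps)
  \<comment> \<open>Left multiplication by a letter plays the role of \<open>e\<close>. Moving it
    past a deletion produces the single correction \<open>- weight\<close>, so \<open>z\<close> is
    zero.\<close>
  have letter: "qshuffle q (letter k) (?S v) = ?S (qshuffle q (letter k) v)" for k v
  proof -
    consider "k = l" | "k = m"
      using assms(2) by (metis xy.exhaust)
    then show ?thesis
    proof cases
      case 1
      then show ?thesis using assms(2)
        by (intro serre_commute_fst[OF assms(1), where z = "\<lambda>v. 0" and z' = "\<lambda>v. - weight q l v"]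
            linear_del_last linear_qshuffle_right)
          (auto simp: del_last_left weight_del_last del_last_simps xy_form_def power_int_minus)
    next
      case 2
      then show ?thesis using assms(2)
        by (intro serre_commute_snd[OF assms(1), where z = "\<lambda>v. 0" and z' = "\<lambda>v. - weight q m v"]
            linear_del_last linear_qshuffle_right)
          (auto simp: del_last_left weight_del_last del_last_simps xy_form_def power_int_minus)
    qed
  qed
  \<comment> \<open>Left multiplication by the subalgebra preserves the kernel of \<open>?S\<close>.
    With \<open>w\<close> arbitrary, associativity reduces the product case to both hypotheses in
    turn; \<open>w = 1\<close> gives the claim.\<close>
  have "?S (qshuffle q v w) = 0" if "?S w = 0" for w
    using assms(3) that
    by (induction arbitrary: w)
       (simp_all add: qshuffle_one_left letter[symmetric] qshuffle_simps linear_simps[OF linear_S]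
         qshuffle_assoc[OF assms(1)])
  from this[of 1] show ?thesis
    by (simp add: qshuffle_one_right serre_def del_last_one del_last_simps)
qed

section \<open>The action of the generators \<open>F\<^sub>i\<close>\<close>

text \<open>The inner diagonal map is the inverse of \<open>weight q l\<close>.  The operators of the theorem are the
  cases \<open>r Lx = q\<close> and \<open>r Ly = 1\<close>; the Serre relation holds for all \<open>r\<close>.\<close>

definition F_op :: "'f::field \<Rightarrow> (xy \<Rightarrow> 'f) \<Rightarrow> xy \<Rightarrow> (xy, 'f) free_alg \<Rightarrow> (xy, 'f) free_alg"
  where "F_op q r l v = scale (1 / (q - inverse q))
    (scale (r l) (qshuffle q (diag (\<lambda>c. q powi - xy_form c l) v) (letter l))
      - scale (inverse (r l)) (qshuffle q (letter l) v))"

lemma linear_F_op: "Vector_Spaces.linear scale scale (F_op q r l)"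
  by (rule linearI)
     (simp_all add: F_op_def qshuffle_simps diag_simps free_alg.scale_right_distrib
       free_alg.scale_right_diff_distrib mult_ac)

lemma diag_F_op:
  assumes "q \<noteq> 0"
  shows "diag c (F_op q r l v) = scale (c l) (F_op q r l (diag c v))"
  by (simp add: F_op_def diag_simps diag_qshuffle[OF assms] diag_letter qshuffle_simps
       diag_commute[of c] free_alg.scale_right_diff_distrib mult_ac)

text \<open>The scalar of \<open>weight q m\<close> on the right factor \<open>letter l\<close>
  cancels the one from moving \<open>del_last m\<close> past the inner diagonal map. The extra term
  comes from deleting the multiplied letter itself.\<close>

lemma del_last_F_op:
  assumes "q \<noteq> 0"
  shows "del_last m (F_op q r l v) = F_op q r l (del_last m v)
    + (if m = l then scale (1 / (q - inverse q))
        (scale (r l) (diag (\<lambda>c. q powi - xy_form c l) v) - scale (inverse (r l)) (weight q l v))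
       else 0)"
proof -
  have "xy_form l m = xy_form m l"
    by (simp add: xy_form_def)
  then show ?thesis
    using assms
    by (simp add: F_op_def del_last_simps del_last_qshuffle[OF assms] del_last_letter
       qshuffle_one_left qshuffle_one_right qshuffle_simps weight_letter del_last_diag
       free_alg.scale_right_diff_distrib free_alg.scale_right_distrib power_int_minus)
qed

lemma serre_F_op:
  assumes "q \<noteq> 0" "l \<noteq> m"
  shows "serre q (F_op q r l) (F_op q r m) v = 0"
proof -
  let ?S = "serre q (F_op q r l) (F_op q r m)"
  \<comment> \<open>The two halves of the commutator of \<open>del_last l\<close> with
    \<open>F_op q r l\<close>; by \<open>diag_F_op\<close> they q-commute with the operators with
    opposite exponents.\<close>
  let ?z = "\<lambda>l v. scale (1 / (q - inverse q)) (- scale (inverse (r l)) (weight q l v))"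
  let ?z' = "\<lambda>l v. scale (1 / (q - inverse q)) (scale (r l) (diag (\<lambda>c. q powi - xy_form c l) v))"
  have commute: "del_last k (?S v) = ?S (del_last k v)" for k v
  proof -
    consider "k = l" | "k = m"
      using assms(2) by (metis xy.exhaust)
    then show ?thesis
    proof cases
      case 1
      then show ?thesis using assms(2)
        by (intro serre_commute_fst[OF assms(1), where z = "?z l" and z' = "?z' l"]
            linear_del_last linear_F_op)
          (auto simp: del_last_F_op[OF assms(1)] weight_def diag_F_op[OF assms(1)] xy_form_def
            linear_simps[OF linear_F_op] power_int_minus free_alg.scale_right_diff_distrib mult_ac)
    next
      case 2
      then show ?thesis using assms(2)
        by (intro serre_commute_snd[OF assms(1), where z = "?z m" and z' = "?z' m"]
            linear_del_last linear_F_op)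
          (auto simp: del_last_F_op[OF assms(1)] weight_def diag_F_op[OF assms(1)] xy_form_def
            linear_simps[OF linear_F_op] power_int_minus free_alg.scale_right_diff_distrib mult_ac)
    qed
  qed
  \<comment> \<open>A shuffle product with a letter has no empty-word term. This is the base case
    for comparing \<open>?S\<close> with the zero map.\<close>
  have "Poly_Mapping.lookup (F_op q r k w) [] = 0" for k w
    by (simp add: F_op_def lookup_minus lookup_qshuffle_Nil letter_def lookup_word)
  then have "Poly_Mapping.lookup (?S v) [] = 0" for v
    by (simp add: serre_def lookup_minus lookup_add)
  then show ?thesis
    by (intro eq_by_del_last[of ?S "\<lambda>_. 0"]) (simp_all add: commute del_last_simps)
qed

section \<open>The module structure\<close>

lemma K_map_eq: "K_map q = diag (\<lambda>c. q powi xy_form c Lx)"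
  unfolding K_map_def diag_def
  by (intro arg_cong[where f = alg_ext] ext) (simp add: xy_form_def split: xy.split)

lemma K_inv_eq: "q \<noteq> 0 \<Longrightarrow> K_inv q = diag (\<lambda>c. q powi xy_form c Ly)"
  unfolding K_inv_def
proof (rule inv_equality)
  have 1: "(\<lambda>c. q powi xy_form c Lx * q powi xy_form c Ly) = (\<lambda>_. 1)" if "q \<noteq> 0"
    using that by (auto simp: xy_form_def power_int_minus fun_eq_iff intro: xy.exhaust)
  fix v assume "q \<noteq> 0"
  then show "K_map q (diag (\<lambda>c. q powi xy_form c Ly) v) = v"
    "diag (\<lambda>c. q powi xy_form c Ly) (K_map q v) = v"
    using 1 by (simp_all add: K_map_eq diag_diag diag_one_fun mult.commute)
qed

lemma X_map_eq: "X_map q = diag (\<lambda>c. if c = Lx then q else 1)"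
  unfolding X_map_def diag_def
  by (intro arg_cong[where f = alg_ext] ext) (simp split: xy.split)

lemma X_inv_eq: "q \<noteq> 0 \<Longrightarrow> X_inv q = diag (\<lambda>c. if c = Lx then inverse q else 1)"
  unfolding X_inv_def
proof (rule inv_equality)
  have 1: "(\<lambda>c. (if c = Lx then q else 1) * (if c = Lx then inverse q else 1)) = (\<lambda>_. 1)" if "q \<noteq> 0"
    using that by auto
  fix v assume "q \<noteq> 0"
  then show "X_map q (diag (\<lambda>c. if c = Lx then inverse q else 1) v) = v"
    "diag (\<lambda>c. if c = Lx then inverse q else 1) (X_map q v) = v"
    using 1 by (simp_all add: X_map_eq diag_diag diag_one_fun mult.commute)
qed

section \<open>Operators assigned to the generators\<close>

fun node_letter :: "node \<Rightarrow> xy" where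
  "node_letter N0 = Lx"
| "node_letter N1 = Ly"

text \<open>Serves twice: as the factor distinguishing node 0 from node 1 in the \<open>K\<close>
  and \<open>F\<close> operators, and as the letter scalars of \<open>X_map\<close>.\<close>

definition shift :: "'f::field \<Rightarrow> xy \<Rightarrow> 'f"
  where "shift q l = (if l = Lx then q else 1)"

fun gen_op :: "'f::field \<Rightarrow> uq_letter \<Rightarrow> (xy, 'f) free_alg \<Rightarrow> (xy, 'f) free_alg" where
  "gen_op q (gK i) v = scale (shift q (node_letter i)) (diag (\<lambda>c. q powi - xy_form c (node_letter i)) v)"
| "gen_op q (gKinv i) v = scale (inverse (shift q (node_letter i))) (weight q (node_letter i) v)"
| "gen_op q gD v = diag (\<lambda>c. inverse (shift q c)) v"
| "gen_op q gDinv v = diag (shift q) v"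
| "gen_op q (gE i) v = del_last (node_letter i) v"
| "gen_op q (gF i) v = F_op q (shift q) (node_letter i) v"

lemma node_letter_inject: "node_letter i = node_letter j \<longleftrightarrow> i = j"
  by (cases i; cases j) simp_all

lemma cartan_eq: "cartan i j = xy_form (node_letter i) (node_letter j)"
  by (simp add: cartan_def xy_form_def node_letter_inject)

lemma linear_gen_op: "Vector_Spaces.linear scale scale (gen_op q g)"
  by (rule linearI; cases g)
     (simp_all add: diag_simps weight_simps del_last_simps linear_simps[OF linear_F_op]
       free_alg.scale_right_distrib mult.commute)

lemma gen_op_qsh_sub:
  assumes "q \<noteq> 0" "v \<in> qsh_sub q"
  shows "gen_op q g v \<in> qsh_sub q"
  using assms
  by (cases g)
     (auto simp: F_op_def weight_def diag_qsh_sub del_last_qsh_sub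
       intro!: qsh_sub.scale qsh_sub.shuffle qsh_sub.letter
         free_alg.subspace_diff[OF subspace_qsh_sub])

lemma word_action_uq_relators:
  assumes q: "q \<noteq> 0" and r: "r \<in> uq_relators q" and v: "v \<in> qsh_sub q"
  shows "word_action (gen_op q) r v = 0"
proof -
  have shift: "shift q l \<noteq> 0" for l
    using q by (simp add: shift_def)
  have sym: "xy_form a b = xy_form b a" for a b
    by (simp add: xy_form_def)
  note simps = word_action_diff word_action_scale word_action_letter word_action_one
    word_action_mult[OF linear_gen_op] commutator_def diag_simps weight_simps del_last_simps
    linear_simps[OF linear_F_op] diag_F_op[OF q] del_last_diag diag_diag weight_def
    shift q power_int_minus diag_one_fun word_action_zero
  show ?thesis
    using r
  proof cases
    \<comment> \<open>Serre relators in the \<open>E\<close> generators: here membership of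
      \<open>v\<close> in the subalgebra enters.\<close>
    case (14 i j)
    then show ?thesis
      using serre_del_last_qsh_sub[OF q _ v, of "node_letter i" "node_letter j"]
      by (simp add: word_action_serre[OF q linear_gen_op] node_letter_inject serre_def)
  next
    case (15 i j)
    then show ?thesis
      using serre_F_op[OF q, of "node_letter i" "node_letter j" "shift q" v]
      by (simp add: word_action_serre[OF q linear_gen_op] node_letter_inject serre_def)
  next
    \<comment> \<open>The extra term of \<open>del_last_F_op\<close> is the action of
      \<open>(K - K^-1) / (q - q^-1)\<close>.\<close>
    case (13 i j)
    then show ?thesis
      by (simp add: simps del_last_F_op[OF q] node_letter_inject)
  qed (simp_all add: simps cartan_eq sym mult.commute shift_def)
qed

theorem theorem10p1:
  fixes q :: "'f::field_char_0"
  assumes q_nonzero: "q \<noteq> 0"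
    and q_not_root_of_unity: "\<forall>n>0. q ^ n \<noteq> 1"
  shows
    "(\<forall>T \<in> {Astar_R, Bstar_R, A_l q, B_l q, A_r q, B_r q,
             X_map q, X_inv q, K_map q, K_inv q}.
        \<forall>v \<in> qsh_sub q. T v \<in> qsh_sub q) \<and>
     (\<exists>act. left_module (Uq q) scale (qsh_sub q) act \<and>
        (\<forall>v \<in> qsh_sub q.
           act (uq_gen q (gE N0)) v = Astar_R v \<and>
           act (uq_gen q (gF N0)) v =
             scale (1 / (q - inverse q))
               (scale q (A_r q (K_inv q v)) - scale (inverse q) (A_l q v)) \<and>
           act (uq_gen q (gK N0)) v = scale q (K_inv q v) \<and>
           act (uq_gen q (gKinv N0)) v = scale (inverse q) (K_map q v) \<and>
           act (uq_gen q (gE N1)) v = Bstar_R v \<and>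
           act (uq_gen q (gF N1)) v =
             scale (1 / (q - inverse q)) (B_r q (K_map q v) - B_l q v) \<and>
           act (uq_gen q (gK N1)) v = K_map q v \<and>
           act (uq_gen q (gKinv N1)) v = K_inv q v \<and>
           act (uq_gen q gD) v = X_inv q v \<and>
           act (uq_gen q gDinv) v = X_map q v))"
proof -
  let ?U = "qsh_sub q"
  have "\<exists>act. left_module (Uq q) scale ?U act \<and> (\<forall>g. \<forall>v\<in>?U. act (uq_gen q g) v = gen_op q g v)"
    unfolding Uq_def uq_gen_def
    by (intro left_module_presented linear_gen_op subspace_qsh_sub gen_op_qsh_sub
        word_action_uq_relators q_nonzero)
  then obtain act where act: "left_module (Uq q) scale ?U act"
    "\<And>g v. v \<in> ?U \<Longrightarrow> act (uq_gen q g) v = gen_op q g v"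
    by blast
  \<comment> \<open>The inverse of \<open>weight\<close> at one letter is \<open>weight\<close> at
    the other; this turns the operators at node 0 into ones in \<open>K_inv\<close> and those at
    node 1 into ones in \<open>K_map\<close>.\<close>
  have form: "- xy_form c Lx = xy_form c Ly" "- xy_form c Ly = xy_form c Lx" for c
    by (cases c; simp add: xy_form_def)+
  have shift: "shift q Lx = q" "shift q Ly = 1" "(\<lambda>c. if c = Lx then q else 1) = shift q"
    "(\<lambda>c. if c = Lx then inverse q else 1) = (\<lambda>c. inverse (shift q c))"
    by (auto simp: shift_def)
  note maps = Astar_R_def Bstar_R_def A_l_def B_l_def A_r_def B_r_def K_map_eq X_map_eq
    K_inv_eq[OF q_nonzero] X_inv_eq[OF q_nonzero]
  show ?thesis
  proof (intro conjI exI[of _ act] act(1) ballI)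
    fix T v
    assume "T \<in> {Astar_R, Bstar_R, A_l q, B_l q, A_r q, B_r q,
             X_map q, X_inv q, K_map q, K_inv q}" and "v \<in> ?U"
    then show "T v \<in> ?U"
      by (auto simp: maps del_last_qsh_sub q_nonzero diag_qsh_sub
          intro!: qsh_sub.shuffle qsh_sub.letter)
  qed (simp_all add: act(2) maps F_op_def form weight_def shift)
qed

end
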